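(* Let $(C,\le)$ be a causal set, fix an integer $r\ge2$, $\alpha\in[0,1]$ and a real $K>0$, and suppose that $\kappa_r^\alpha(\gamma)\ge K$ for all maximising geodesics $\gamma=(x_0,\dots,x_{n+r})$ in $C$ and all integers $n\ge r$. Then for every such $\gamma$ $$\tau(x_0,x_{n+r})\le r+\frac{J_r^\alpha(\gamma)}{K},\qquad\text{where}\quad J_r^\alpha(\gamma):=r-\ell_1(\delta_{x_0},\mu_{x_0}^\alpha)-\ell_1(\mu_{x_n}^\alpha,\delta_{x_{n+r}}).$$ Moreover, if $\mathrm{diam}_\tau(C)\ge 2r$, then $$\mathrm{diam}_\tau(C)\le r+\frac{\sup_\gamma J_r^\alpha(\gamma)}{K},$$ where the supremum is over all maximising geodesics $\gamma=(x_0,\dots,x_{n+r})$ with $n\ge r$; and for each such $\gamma$: if $r=2$, $$J_2^\alpha(\gamma)\le(1-\alpha)\left(\frac1{N_y-1}-\frac1{N_x-1}\right)\le\frac{1-\alpha}2,$$ while if $r>2$, $$J_r^\alpha(\gamma)\le(1-\alpha)\left(r-2-\frac{r(r-1)}{2(N_x-1)}-\frac{r(r-3)}{2(N_y-1)}\right)<(1-\alpha)(r-2).$$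
   Context: A causal set is a pair $(C,\le)$ where $\le$ is a partial order on the set $C$ such that every causal diamond $J(x,z)=\{y\in C:x\le y\le z\}$ is finite. Write $x\ll y$ if $x\le y$ and $x\ne y$. The time separation is $\tau(x,y)=\max\{m: x=z_0\ll z_1\ll\dots\ll z_m=y\}$ if $x\le y$, and $\tau(x,y)=0$ otherwise; $\mathrm{diam}_\tau(C)=\sup\{\tau(x,y):x\le y\}$. A chain $x_0\ll\dots\ll x_m$ is a (maximising) geodesic if $m=\tau(x_0,x_m)$. For finitely supported probability measures $\mu,\nu$ on $C$, $\ell_1(\mu,\nu)=\max_\pi\sum_{a,b}\pi(a,b)\tau(a,b)$ over couplings $\pi$ of $\mu,\nu$ with $\pi(a,b)=0$ whenever $a\not\le b$ ($-\infty$ if none exist). For integers $n\ge r\ge1$, a maximising geodesic $\gamma=(x_0,\dots,x_{n+r})$ and $\alpha\in[0,1]$, put $x=x_0$, $y=x_n$, $N_x=|J(x,x_r)|$, $N_y=|J(y,x_{n+r})|$, $$\mu_{x_0}^\alpha=\mu_x^\alpha=\alpha\delta_x+\frac{1-\alpha}{N_x-1}\sum_{z\in J(x,x_r)\setminus\{x\}}\delta_z,\qquad \mu_{x_n}^\alpha=\mu_y^\alpha=\alpha\delta_y+\frac{1-\alpha}{N_y-1}\sum_{z\in J(y,x_{n+r})\setminus\{y\}}\delta_z,$$ and $\kappa_r^\alpha(\gamma)=\frac{\ell_1(\mu_x^\alpha,\mu_y^\alpha)}{\tau(x,y)}-1$. $\delta_z$ is the Dirac mass at $z$. *)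

theory Defs
  imports "HOL-Probability.Probability"
begin

text \<open>The order on the carrier \<open>C\<close> is a relation \<open>R\<close> contained in \<open>C \<times> C\<close>
  (this inclusion is part of \<^const>\<open>partial_order_on\<close>).\<close>

definition diamond :: "'a rel \<Rightarrow> 'a \<Rightarrow> 'a \<Rightarrow> 'a set" where
  "diamond R x z = {y. (x, y) \<in> R \<and> (y, z) \<in> R}"

definition causal_set :: "'a set \<Rightarrow> 'a rel \<Rightarrow> bool" where
  "causal_set C R \<longleftrightarrow>
     partial_order_on C R \<and> (\<forall>x\<in>C. \<forall>z\<in>C. finite (diamond R x z))"

definition prec :: "'a rel \<Rightarrow> 'a \<Rightarrow> 'a \<Rightarrow> bool" where
  "prec R x y \<longleftrightarrow> (x, y) \<in> R \<and> x \<noteq> y"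

text \<open>A tuple \<open>(z\<^sub>0, \<dots>, z\<^sub>m)\<close> is given by a function on \<^typ>\<open>nat\<close> together with \<open>m\<close>;
  the values of the function beyond \<open>m\<close> are irrelevant.\<close>

definition causal_chain :: "'a rel \<Rightarrow> (nat \<Rightarrow> 'a) \<Rightarrow> nat \<Rightarrow> bool" where
  "causal_chain R z m \<longleftrightarrow> (\<forall>i<m. prec R (z i) (z (Suc i)))"

text \<open>In a causal set the maximum below is over a finite set, because the points of a chain
  from \<open>x\<close> to \<open>y\<close> are distinct elements of the finite set \<open>diamond R x y\<close>.\<close>

definition time_sep :: "'a rel \<Rightarrow> 'a \<Rightarrow> 'a \<Rightarrow> nat" where
  "time_sep R x y =
     (if (x, y) \<in> R then Max {m. \<exists>z. z 0 = x \<and> z m = y \<and> causal_chain R z m} else 0)"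

definition diam :: "'a rel \<Rightarrow> ereal" where
  "diam R = (SUP (x, y)\<in>R. ereal (real (time_sep R x y)))"

definition geodesic :: "'a set \<Rightarrow> 'a rel \<Rightarrow> (nat \<Rightarrow> 'a) \<Rightarrow> nat \<Rightarrow> bool" where
  "geodesic C R \<gamma> m \<longleftrightarrow>
     \<gamma> ` {..m} \<subseteq> C \<and> causal_chain R \<gamma> m \<and> m = time_sep R (\<gamma> 0) (\<gamma> m)"

definition causal_couplings :: "'a rel \<Rightarrow> 'a pmf \<Rightarrow> 'a pmf \<Rightarrow> ('a \<times> 'a) pmf set" where
  "causal_couplings R \<mu> \<nu> =
     {\<pi>. map_pmf fst \<pi> = \<mu> \<and> map_pmf snd \<pi> = \<nu> \<and> (\<forall>a b. (a, b) \<notin> R \<longrightarrow> pmf \<pi> (a, b) = 0)}"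

text \<open>For finitely supported \<open>\<mu>\<close> and \<open>\<nu>\<close>. The objective is linear on a compact polytope of
  couplings, so the supremum is attained when there is a coupling; over the empty set it
  is \<open>-\<infinity>\<close>.\<close>

definition ell1 :: "'a rel \<Rightarrow> 'a pmf \<Rightarrow> 'a pmf \<Rightarrow> ereal" where
  "ell1 R \<mu> \<nu> =
     (SUP \<pi>\<in>causal_couplings R \<mu> \<nu>.
        ereal (\<Sum>a\<in>set_pmf \<mu>. \<Sum>b\<in>set_pmf \<nu>. pmf \<pi> (a, b) * real (time_sep R a b)))"

text \<open>With \<open>x = x\<^sub>i\<close> and \<open>x' = x\<^sub>i\<^sub>+\<^sub>r\<close>, this is the measure \<open>\<mu>\<close> based at \<open>x\<^sub>i\<close>:
  the mixture, with weights \<open>\<alpha>\<close> and \<open>1 - \<alpha>\<close>, of the Dirac mass at \<open>x\<close> and the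
  uniform distribution on \<open>diamond R x x' - {x}\<close>. Its point masses are computed in
  \<open>pmf_lazy_measure\<close>.\<close>

definition lazy_measure :: "'a rel \<Rightarrow> real \<Rightarrow> 'a \<Rightarrow> 'a \<Rightarrow> 'a pmf" where
  "lazy_measure R \<alpha> x x' =
     bind_pmf (bernoulli_pmf \<alpha>)
       (\<lambda>b. if b then return_pmf x else pmf_of_set (diamond R x x' - {x}))"

lemma pmf_lazy_measure:
  assumes "causal_set C R" and "0 \<le> \<alpha>" and "\<alpha> \<le> 1" and "prec R x x'"
  shows "pmf (lazy_measure R \<alpha> x x') z =
    \<alpha> * indicator {x} z +
    (1 - \<alpha>) / (real (card (diamond R x x')) - 1) * indicator (diamond R x x' - {x}) z"
proof -
  have po: "R \<subseteq> C \<times> C" "refl_on C R" and R: "(x, x') \<in> R" "x \<noteq> x'"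
    using assms by (auto simp: causal_set_def order_on_defs prec_def)
  then have mem: "x \<in> diamond R x x'" "x' \<in> diamond R x x' - {x}"
    by (auto simp: diamond_def refl_on_def)
  have fin: "finite (diamond R x x')"
    using assms(1) po R by (auto simp: causal_set_def)
  have "1 \<le> card (diamond R x x')"
    using fin mem by (simp add: Suc_le_eq card_gt_0_iff) blast
  then have "real (card (diamond R x x' - {x})) = real (card (diamond R x x')) - 1"
    using mem by (simp add: of_nat_diff)
  moreover have "diamond R x x' - {x} \<noteq> {}" "finite (diamond R x x' - {x})"
    using mem fin by auto
  ultimately show ?thesis
    using assms(2,3)
    by (simp add: lazy_measure_def pmf_bind indicator_def pmf_return)
qed

definition curvature :: "'a rel \<Rightarrow> nat \<Rightarrow> real \<Rightarrow> nat \<Rightarrow> (nat \<Rightarrow> 'a) \<Rightarrow> ereal" where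
  "curvature R r \<alpha> n \<gamma> =
     ell1 R (lazy_measure R \<alpha> (\<gamma> 0) (\<gamma> r)) (lazy_measure R \<alpha> (\<gamma> n) (\<gamma> (n + r)))
       / ereal (real (time_sep R (\<gamma> 0) (\<gamma> n))) - 1"

definition defect :: "'a rel \<Rightarrow> nat \<Rightarrow> real \<Rightarrow> nat \<Rightarrow> (nat \<Rightarrow> 'a) \<Rightarrow> ereal" where
  "defect R r \<alpha> n \<gamma> =
     ereal (real r)
       - ell1 R (return_pmf (\<gamma> 0)) (lazy_measure R \<alpha> (\<gamma> 0) (\<gamma> r))
       - ell1 R (lazy_measure R \<alpha> (\<gamma> n) (\<gamma> (n + r))) (return_pmf (\<gamma> (n + r)))"

end

theory Submission
  imports Defs
begin

text \<open>Along any causal coupling \<open>\<pi>\<close> of \<open>\<mu>\<^sub>x\<close> and \<open>\<mu>\<^sub>y\<close> the reverse triangle inequality gives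
  \<open>\<tau> x\<^sub>0 a + \<tau> a b + \<tau> b x\<^sub>n\<^sub>+\<^sub>r \<le> n + r\<close>. Integrating over \<open>\<pi>\<close> yields
  \<open>ell1 \<mu>\<^sub>x \<mu>\<^sub>y \<le> n + J\<close>, whereas the curvature bound says \<open>ell1 \<mu>\<^sub>x \<mu>\<^sub>y \<ge> (1 + K) n\<close>;
  hence \<open>K n \<le> J\<close>. The bounds on \<open>J\<close> come from \<open>\<tau>\<close> being at least the index difference
  along the geodesic and at least \<open>1\<close> at the other points of the diamonds.\<close>

section \<open>Chains: transitivity and concatenation\<close>

lemma causal_chain_mono:
  assumes "trans R" "antisym R" "causal_chain R z m" "i < j" "j \<le> m"
  shows "prec R (z i) (z j)"
  using assms(4,5)
proof (induction j)
  case (Suc j)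
  have step: "prec R (z j) (z (Suc j))"
    using assms(3) Suc.prems by (simp add: causal_chain_def)
  show ?case
  proof (cases "i = j")
    case False
    then have "prec R (z i) (z j)"
      using Suc by simp
    \<comment> \<open>If \<open>z i = z (Suc j)\<close>, the two relations would close a cycle and
      antisymmetry would give \<open>z i = z j\<close>.\<close>
    with step assms(1,2) show ?thesis
      unfolding prec_def by (metis transD antisymD)
  qed (use step in simp)
qed simp

lemma causal_chain_append:
  assumes "causal_chain R z m" "causal_chain R w k" "z m = w 0"
  shows "causal_chain R (\<lambda>i. if i \<le> m then z i else w (i - m)) (m + k)"
  unfolding causal_chain_def
proof (intro allI impI)
  fix i assume i: "i < m + k"
  \<comment> \<open>The case \<open>i = m\<close> is the junction, where \<open>z m = w 0\<close>
    turns the step into the first step of \<open>w\<close>.\<close>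
  consider "i < m" | "i = m" | "m < i" by linarith
  then show "prec R (if i \<le> m then z i else w (i - m))
      (if Suc i \<le> m then z (Suc i) else w (Suc i - m))"
  proof cases
    case 3
    then have "Suc i - m = Suc (i - m)" by simp
    with 3 i assms(2) show ?thesis by (simp add: causal_chain_def)
  qed (use i assms in \<open>auto simp: causal_chain_def\<close>)
qed

section \<open>Time separation and geodesics in a causal set\<close>

context
  fixes C :: "'a set" and R :: "'a rel"
  assumes causal: "causal_set C R"
begin

lemma causal_set_order:
  shows "trans R" "antisym R" "R \<subseteq> C \<times> C" "refl_on C R"
  using causal by (auto simp: causal_set_def order_on_defs)

lemma finite_diamond: "finite (diamond R x y)"
proof (cases "x \<in> C \<and> y \<in> C")
  case False
  then have "diamond R x y = {}"
    using causal_set_order(3) by (auto simp: diamond_def)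
  then show ?thesis by simp
qed (use causal in \<open>simp add: causal_set_def\<close>)

text \<open>Reflexivity holds only on \<open>C\<close>, and a chain of length 0 does not force its
  point into \<open>C\<close>; hence the assumption on the image.\<close>

lemma causal_chain_in_diamond:
  assumes "causal_chain R z m" "z ` {..m} \<subseteq> C" "i \<le> j" "j \<le> k" "k \<le> m"
  shows "z j \<in> diamond R (z i) (z k)"
proof -
  have *: "(z a, z b) \<in> R" if "a \<le> b" "b \<le> m" for a b
  proof (cases "a = b")
    case True
    then show ?thesis
      using that assms(2) causal_set_order(4) by (auto simp: refl_on_def)
  next
    case False
    then show ?thesis
      using causal_chain_mono[OF causal_set_order(1,2) assms(1)] that by (simp add: prec_def)
  qed
  show ?thesis
    using assms(3-5) by (auto simp: diamond_def intro!: *)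
qed

lemma inj_on_causal_chain:
  assumes "causal_chain R z m"
  shows "inj_on z {..m}"
  by (rule linorder_inj_onI')
    (use causal_chain_mono[OF causal_set_order(1,2) assms] in \<open>auto simp: prec_def\<close>)

lemma finite_chain_lengths:
  "finite {m. \<exists>z. z 0 = x \<and> z m = y \<and> causal_chain R z m}"
\<comment> \<open>Length 0 is split off: for \<open>m > 0\<close> every point of the chain is
  related to another one, hence lies in \<open>C\<close>, and the \<open>m + 1\<close> distinct
  points fit into the diamond.\<close>
proof (rule finite_subset[of _ "insert 0 {..card (diamond R x y)}"])
  have "m \<le> card (diamond R (z 0) (z m))" if z: "causal_chain R z m" "m > 0" for z m
  proof -
    have "z i \<in> C" if "i \<le> m" for i
    proof (cases "i < m")
      case True
      then have "prec R (z i) (z (Suc i))"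
        using z by (simp add: causal_chain_def)
      then show ?thesis
        using causal_set_order(3) by (auto simp: prec_def)
    next
      case False
      then have "prec R (z 0) (z i)"
        using causal_chain_mono[OF causal_set_order(1,2) z(1), of 0 i] z(2) that by simp
      then show ?thesis
        using causal_set_order(3) by (auto simp: prec_def)
    qed
    then have "z ` {..m} \<subseteq> diamond R (z 0) (z m)"
      using causal_chain_in_diamond[OF z(1)] by (simp add: image_subset_iff)
    then have "card (z ` {..m}) \<le> card (diamond R (z 0) (z m))"
      by (intro card_mono finite_diamond)
    then show ?thesis
      using card_image[OF inj_on_causal_chain[OF z(1)]] by simp
  qed
  then show "{m. \<exists>z. z 0 = x \<and> z m = y \<and> causal_chain R z m}
      \<subseteq> insert 0 {..card (diamond R x y)}"
    by auto
qed simp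

lemma time_sep_ge:
  assumes "causal_chain R z m"
  shows "m \<le> time_sep R (z 0) (z m)"
\<comment> \<open>For \<open>m > 0\<close> the endpoints are related, so \<open>time_sep\<close> is
  the maximum and not its default value 0.\<close>
proof (cases "m = 0")
  case False
  then have "(z 0, z m) \<in> R"
    using causal_chain_mono[OF causal_set_order(1,2) assms, of 0 m] by (simp add: prec_def)
  then show ?thesis
    unfolding time_sep_def using assms by (auto intro!: Max_ge finite_chain_lengths)
qed simp

lemma time_sep_ge_one:
  assumes "prec R x y"
  shows "1 \<le> time_sep R x y"
  using time_sep_ge[of "\<lambda>i. if i = 0 then x else y" 1] assms by (simp add: causal_chain_def)

lemma time_sep_chain_ge:
  assumes "causal_chain R z m" "i \<le> j" "j \<le> m"
  shows "j - i \<le> time_sep R (z i) (z j)"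
  using time_sep_ge[of "\<lambda>k. z (i + k)" "j - i"] assms by (simp add: causal_chain_def)

lemma time_sep_attained:
  assumes "(x, y) \<in> R"
  obtains z where "z 0 = x" "z (time_sep R x y) = y" "causal_chain R z (time_sep R x y)"
proof -
  let ?M = "{m. \<exists>z. z 0 = x \<and> z m = y \<and> causal_chain R z m}"
  \<comment> \<open>A trivial chain of length 0 or 1 shows that the set of lengths is nonempty, so
    its maximum is attained.\<close>
  have "(if x = y then 0 else 1) \<in> ?M"
    using assms
    by (auto simp: causal_chain_def prec_def intro!: exI[of _ "\<lambda>i. if i = (0::nat) then x else y"])
  then have "Max ?M \<in> ?M"
    by (intro Max_in finite_chain_lengths) auto
  then show ?thesis
    using that assms by (auto simp: time_sep_def)
qed

text \<open>A longest chain from \<open>x\<close> to \<open>y\<close> followed by a longest one from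
  \<open>y\<close> to \<open>z\<close> is a chain from \<open>x\<close> to \<open>z\<close>.\<close>

lemma time_sep_reverse_triangle:
  assumes "(x, y) \<in> R" "(y, z) \<in> R"
  shows "time_sep R x y + time_sep R y z \<le> time_sep R x z"
proof -
  let ?m = "time_sep R x y" and ?k = "time_sep R y z"
  obtain u where u: "u 0 = x" "u ?m = y" "causal_chain R u ?m"
    by (rule time_sep_attained[OF assms(1)])
  obtain v where v: "v 0 = y" "v ?k = z" "causal_chain R v ?k"
    by (rule time_sep_attained[OF assms(2)])
  have "causal_chain R (\<lambda>i. if i \<le> ?m then u i else v (i - ?m)) (?m + ?k)"
    by (rule causal_chain_append[OF u(3) v(3)]) (simp add: u v)
  from time_sep_ge[OF this] show ?thesis
    using u v by (auto split: if_splits)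
qed

text \<open>A longer chain to \<open>\<gamma> n\<close> would, by the reverse triangle inequality,
  beat the whole geodesic. This identifies the denominator \<open>n\<close> in the
  curvature.\<close>

lemma geodesic_time_sep:
  assumes "geodesic C R \<gamma> m" "n \<le> m"
  shows "time_sep R (\<gamma> 0) (\<gamma> n) = n"
proof -
  have g: "causal_chain R \<gamma> m" "\<gamma> ` {..m} \<subseteq> C" "time_sep R (\<gamma> 0) (\<gamma> m) = m"
    using assms(1) by (simp_all add: geodesic_def)
  have "time_sep R (\<gamma> 0) (\<gamma> n) + time_sep R (\<gamma> n) (\<gamma> m) \<le> m"
    using time_sep_reverse_triangle[of "\<gamma> 0" "\<gamma> n" "\<gamma> m"] g(3) assms(2)
      causal_chain_in_diamond[OF g(1,2), of 0 n m] by (simp add: diamond_def)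
  moreover have "m - n \<le> time_sep R (\<gamma> n) (\<gamma> m)" "n \<le> time_sep R (\<gamma> 0) (\<gamma> n)"
    using time_sep_chain_ge[OF g(1), of n m] time_sep_chain_ge[OF g(1), of 0 n] assms(2)
    by simp_all
  ultimately show ?thesis
    using assms(2) by linarith
qed

text \<open>Carries bounds along geodesics over to pairs of related points, as the diameter
  requires.\<close>

lemma obtain_geodesic:
  assumes "(x, y) \<in> R"
  obtains \<gamma> where "\<gamma> 0 = x" "\<gamma> (time_sep R x y) = y" "geodesic C R \<gamma> (time_sep R x y)"
proof -
  let ?m = "time_sep R x y"
  obtain z where z: "z 0 = x" "z ?m = y" "causal_chain R z ?m"
    by (rule time_sep_attained[OF assms])
  have "z i \<in> C" if "i \<le> ?m" for i
  proof (cases "i = 0")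
    case True
    then show ?thesis using z assms causal_set_order(3) by auto
  next
    case False
    then have "prec R (z 0) (z i)"
      using causal_chain_mono[OF causal_set_order(1,2) z(3), of 0 i] that by simp
    then show ?thesis
      using causal_set_order(3) by (auto simp: prec_def)
  qed
  then show ?thesis
    using that[OF z(1,2)] z by (auto simp: geodesic_def)
qed

section \<open>Support and expectations of the lazy measures\<close>

lemma lazy_measure_support:
  assumes "prec R x x'"
  shows "set_pmf (lazy_measure R \<alpha> x x') \<subseteq> diamond R x x'"
proof -
  have mem: "x \<in> diamond R x x'" "x' \<in> diamond R x x' - {x}"
    using assms causal_set_order(3,4) by (auto simp: prec_def diamond_def refl_on_def)
  then have unif: "set_pmf (pmf_of_set (diamond R x x' - {x})) = diamond R x x' - {x}"
    using finite_diamond by (intro set_pmf_of_set) auto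
  have "set_pmf (if b then return_pmf x else pmf_of_set (diamond R x x' - {x}))
      \<subseteq> diamond R x x'" for b
    using mem(1) unif by (cases b) auto
  then show ?thesis
    unfolding lazy_measure_def set_bind_pmf by (rule UN_least)
qed

lemma finite_lazy_measure_support:
  assumes "prec R x x'"
  shows "finite (set_pmf (lazy_measure R \<alpha> x x'))"
  using lazy_measure_support[OF assms] finite_diamond by (rule finite_subset)

lemma expectation_lazy_measure:
  fixes f :: "'a \<Rightarrow> real"
  assumes "prec R x x'" "0 \<le> \<alpha>" "\<alpha> \<le> 1"
  shows "measure_pmf.expectation (lazy_measure R \<alpha> x x') f =
    \<alpha> * f x + (1 - \<alpha>) / (real (card (diamond R x x')) - 1) * (\<Sum>z\<in>diamond R x x' - {x}. f z)"
proof -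
  let ?D = "diamond R x x'" and ?c = "(1 - \<alpha>) / (real (card (diamond R x x')) - 1)"
  have x: "x \<in> ?D"
    using assms causal_set_order(3,4) by (auto simp: prec_def diamond_def refl_on_def)
  have "measure_pmf.expectation (lazy_measure R \<alpha> x x') f =
      (\<Sum>z\<in>?D. pmf (lazy_measure R \<alpha> x x') z * f z)"
    using lazy_measure_support[OF assms(1), of \<alpha>]
    by (subst integral_measure_pmf[OF finite_diamond[of x x']]) auto
  also have "\<dots> = \<alpha> * f x + (\<Sum>z\<in>?D - {x}. ?c * f z)"
    using x by (simp add: sum.remove[OF finite_diamond x] indicator_def
        pmf_lazy_measure[OF causal assms(2,3,1)])
  finally show ?thesis
    by (simp add: sum_distrib_left)
qed

end

text \<open>\<open>A\<close> splits into the image of \<open>c\<close>, where \<open>g\<close> is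
  the lower bound, and the rest, where each point counts at least 1. Later \<open>c\<close> follows
  the geodesic and \<open>A\<close> is a diamond without its base point.\<close>

lemma sum_ge_along_injection:
  fixes f :: "'a \<Rightarrow> real"
  assumes "finite A" "inj_on c I" "c ` I \<subseteq> A"
    and "\<And>i. i \<in> I \<Longrightarrow> g i \<le> f (c i)" and "\<And>z. z \<in> A - c ` I \<Longrightarrow> 1 \<le> f z"
  shows "sum g I + (real (card A) - real (card I)) \<le> sum f A"
proof -
  have "real (card (A - c ` I)) = real (card A) - real (card I)"
    using assms(1-3) card_mono[OF assms(1,3)]
    by (simp add: card_Diff_subset finite_subset card_image of_nat_diff)
  moreover have "real (card (A - c ` I)) \<le> sum f (A - c ` I)"
    using sum_mono[of "A - c ` I" "\<lambda>_. 1" f] assms(5) by simp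
  moreover have "sum g I \<le> sum f (c ` I)"
    using assms(2,4) by (simp add: sum.reindex sum_mono)
  moreover have "sum f A = sum f (A - c ` I) + sum f (c ` I)"
    by (rule sum.subset_diff[OF assms(3,1)])
  ultimately show ?thesis by linarith
qed

section \<open>Causal transport: expectations, Dirac marginals and an upper bound\<close>

lemma ell1_expectation:
  assumes "finite (set_pmf \<mu>)" "finite (set_pmf \<nu>)"
  shows "ell1 R \<mu> \<nu> = (SUP \<pi>\<in>causal_couplings R \<mu> \<nu>.
    ereal (measure_pmf.expectation \<pi> (\<lambda>p. real (time_sep R (fst p) (snd p)))))"
  unfolding ell1_def
proof (rule SUP_cong[OF refl])
  fix \<pi> assume "\<pi> \<in> causal_couplings R \<mu> \<nu>"
  then have "\<mu> = map_pmf fst \<pi>" "\<nu> = map_pmf snd \<pi>"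
    by (auto simp: causal_couplings_def)
  \<comment> \<open>All mass of \<open>\<pi>\<close> sits on the product of the marginal supports,
    so the double sum is the full integral.\<close>
  then have "set_pmf \<pi> \<subseteq> set_pmf \<mu> \<times> set_pmf \<nu>"
    by force
  then have "measure_pmf.expectation \<pi> (\<lambda>p. real (time_sep R (fst p) (snd p))) =
      (\<Sum>p\<in>set_pmf \<mu> \<times> set_pmf \<nu>. pmf \<pi> p * real (time_sep R (fst p) (snd p)))"
    using assms by (subst integral_measure_pmf[of "set_pmf \<mu> \<times> set_pmf \<nu>"]) auto
  then show "ereal (\<Sum>a\<in>set_pmf \<mu>. \<Sum>b\<in>set_pmf \<nu>. pmf \<pi> (a, b) * real (time_sep R a b)) =
      ereal (measure_pmf.expectation \<pi> (\<lambda>p. real (time_sep R (fst p) (snd p))))"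
    by (simp add: sum.cartesian_product case_prod_beta)
qed

text \<open>A Dirac marginal leaves only the product coupling, so the supremum in
  \<open>ell1\<close> runs over a single element.\<close>

lemma causal_couplings_return_left:
  assumes "\<And>b. b \<in> set_pmf \<nu> \<Longrightarrow> (x, b) \<in> R"
  shows "causal_couplings R (return_pmf x) \<nu> = {map_pmf (Pair x) \<nu>}"
proof -
  have "\<pi> = map_pmf (Pair x) \<nu>" if "map_pmf fst \<pi> = return_pmf x" "map_pmf snd \<pi> = \<nu>" for \<pi>
  proof -
    have "fst p = x" if "p \<in> set_pmf \<pi>" for p
      using arg_cong[OF \<open>map_pmf fst \<pi> = return_pmf x\<close>, of set_pmf] that by auto
    then have "map_pmf (\<lambda>p. (x, snd p)) \<pi> = map_pmf (\<lambda>p. p) \<pi>"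
      by (intro map_pmf_cong) auto
    then show ?thesis
      by (simp add: \<open>map_pmf snd \<pi> = \<nu>\<close>[symmetric] pmf.map_comp comp_def)
  qed
  moreover have "map_pmf (Pair x) \<nu> \<in> causal_couplings R (return_pmf x) \<nu>"
    using assms
    by (auto simp: causal_couplings_def pmf.map_comp comp_def pmf_eq_0_set_pmf map_pmf_const)
  ultimately show ?thesis
    by (auto simp: causal_couplings_def)
qed

lemma causal_couplings_return_right:
  assumes "\<And>a. a \<in> set_pmf \<mu> \<Longrightarrow> (a, y) \<in> R"
  shows "causal_couplings R \<mu> (return_pmf y) = {map_pmf (\<lambda>a. (a, y)) \<mu>}"
proof -
  have "\<pi> = map_pmf (\<lambda>a. (a, y)) \<mu>" if "map_pmf snd \<pi> = return_pmf y" "map_pmf fst \<pi> = \<mu>" for \<pi>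
  proof -
    have "snd p = y" if "p \<in> set_pmf \<pi>" for p
      using arg_cong[OF \<open>map_pmf snd \<pi> = return_pmf y\<close>, of set_pmf] that by auto
    then have "map_pmf (\<lambda>p. (fst p, y)) \<pi> = map_pmf (\<lambda>p. p) \<pi>"
      by (intro map_pmf_cong) auto
    then show ?thesis
      by (simp add: \<open>map_pmf fst \<pi> = \<mu>\<close>[symmetric] pmf.map_comp comp_def)
  qed
  moreover have "map_pmf (\<lambda>a. (a, y)) \<mu> \<in> causal_couplings R \<mu> (return_pmf y)"
    using assms
    by (auto simp: causal_couplings_def pmf.map_comp comp_def pmf_eq_0_set_pmf map_pmf_const)
  ultimately show ?thesis
    by (auto simp: causal_couplings_def)
qed

lemma ell1_return_left:
  assumes "finite (set_pmf \<nu>)" "\<And>b. b \<in> set_pmf \<nu> \<Longrightarrow> (x, b) \<in> R"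
  shows "ell1 R (return_pmf x) \<nu> =
    ereal (measure_pmf.expectation \<nu> (\<lambda>b. real (time_sep R x b)))"
  using assms by (simp add: ell1_expectation causal_couplings_return_left)

lemma ell1_return_right:
  assumes "finite (set_pmf \<mu>)" "\<And>a. a \<in> set_pmf \<mu> \<Longrightarrow> (a, y) \<in> R"
  shows "ell1 R \<mu> (return_pmf y) =
    ereal (measure_pmf.expectation \<mu> (\<lambda>a. real (time_sep R a y)))"
  using assms by (simp add: ell1_expectation causal_couplings_return_right)

text \<open>The reverse triangle inequality, applied twice at each \<open>(a, b)\<close> in the
  support of a coupling and then integrated; the outer terms see only the marginals. Without causal
  couplings the supremum is \<open>-\<infinity>\<close> and the bound is trivial.\<close>

lemma ell1_le_time_sep_minus:
  assumes "causal_set C R" and fin: "finite (set_pmf \<mu>)" "finite (set_pmf \<nu>)"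
    and \<mu>: "\<And>a. a \<in> set_pmf \<mu> \<Longrightarrow> (x, a) \<in> R" and \<nu>: "\<And>b. b \<in> set_pmf \<nu> \<Longrightarrow> (b, y) \<in> R"
  shows "ell1 R \<mu> \<nu> \<le> ereal (real (time_sep R x y)
    - measure_pmf.expectation \<mu> (\<lambda>a. real (time_sep R x a))
    - measure_pmf.expectation \<nu> (\<lambda>b. real (time_sep R b y)))"
  unfolding ell1_expectation[OF fin]
proof (rule SUP_least)
  fix \<pi> assume \<pi>: "\<pi> \<in> causal_couplings R \<mu> \<nu>"
  then have marg: "map_pmf fst \<pi> = \<mu>" "map_pmf snd \<pi> = \<nu>"
    by (auto simp: causal_couplings_def)
  have sub: "set_pmf \<pi> \<subseteq> set_pmf \<mu> \<times> set_pmf \<nu>"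
    using marg by force
  then have finp: "finite (set_pmf \<pi>)"
    using fin by (meson finite_SigmaI finite_subset)
  note int = integrable_measure_pmf_finite[OF finp]
  let ?t = "\<lambda>a b. real (time_sep R a b)"
  have "?t x (fst p) + ?t (fst p) (snd p) + ?t (snd p) y \<le> ?t x y" if "p \<in> set_pmf \<pi>" for p
  proof -
    have R: "(x, fst p) \<in> R" "(fst p, snd p) \<in> R" "(snd p, y) \<in> R"
      using that sub \<pi> \<mu> \<nu>
      by (cases p; force simp: causal_couplings_def pmf_eq_0_set_pmf)+
    moreover have "(x, snd p) \<in> R"
      using R causal_set_order(1)[OF assms(1)] by (meson transD)
    ultimately have "time_sep R x (fst p) + time_sep R (fst p) (snd p) \<le> time_sep R x (snd p)"
      "time_sep R x (snd p) + time_sep R (snd p) y \<le> time_sep R x y"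
      by (auto intro!: time_sep_reverse_triangle[OF assms(1)])
    then show ?thesis by linarith
  qed
  then have "measure_pmf.expectation \<pi> (\<lambda>p. ?t x (fst p) + ?t (fst p) (snd p) + ?t (snd p) y)
      \<le> measure_pmf.expectation \<pi> (\<lambda>p. ?t x y)"
    by (intro integral_mono_AE int) (simp add: AE_measure_pmf_iff)
  then show "ereal (measure_pmf.expectation \<pi> (\<lambda>p. ?t (fst p) (snd p))) \<le>
      ereal (?t x y - measure_pmf.expectation \<mu> (?t x) - measure_pmf.expectation \<nu> (\<lambda>b. ?t b y))"
    by (simp add: int marg[symmetric])
qed

section \<open>Estimates along one fixed geodesic\<close>

locale causal_geodesic =
  fixes C :: "'a set" and R :: "'a rel" and r n :: nat and \<alpha> :: real and \<gamma> :: "nat \<Rightarrow> 'a"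
  assumes causal: "causal_set C R" and r: "2 \<le> r" "r \<le> n"
    and \<alpha>: "0 \<le> \<alpha>" "\<alpha> \<le> 1"
    and geo: "geodesic C R \<gamma> (n + r)"
begin

abbreviation "Dx \<equiv> diamond R (\<gamma> 0) (\<gamma> r)"
abbreviation "Dy \<equiv> diamond R (\<gamma> n) (\<gamma> (n + r))"
abbreviation "\<mu>x \<equiv> lazy_measure R \<alpha> (\<gamma> 0) (\<gamma> r)"
abbreviation "\<mu>y \<equiv> lazy_measure R \<alpha> (\<gamma> n) (\<gamma> (n + r))"
abbreviation "mean_x \<equiv> measure_pmf.expectation \<mu>x (\<lambda>z. real (time_sep R (\<gamma> 0) z))"
abbreviation "mean_y \<equiv> measure_pmf.expectation \<mu>y (\<lambda>z. real (time_sep R z (\<gamma> (n + r))))"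

lemma chain: "causal_chain R \<gamma> (n + r)" "\<gamma> ` {..n + r} \<subseteq> C"
  using geo by (simp_all add: geodesic_def)

lemma prec_ends: "prec R (\<gamma> 0) (\<gamma> r)" "prec R (\<gamma> n) (\<gamma> (n + r))"
  using r causal_chain_mono[OF causal_set_order(1,2)[OF causal] chain(1)] by simp_all

lemma lazy_supports:
  "finite (set_pmf \<mu>x)" "finite (set_pmf \<mu>y)"
  "z \<in> set_pmf \<mu>x \<Longrightarrow> (\<gamma> 0, z) \<in> R" "z \<in> set_pmf \<mu>y \<Longrightarrow> (z, \<gamma> (n + r)) \<in> R"
  using finite_lazy_measure_support[OF causal] prec_ends
    lazy_measure_support[OF causal prec_ends(1), of \<alpha>]
    lazy_measure_support[OF causal prec_ends(2), of \<alpha>]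
  by (auto simp: diamond_def)

text \<open>Both transports in the defect have a Dirac marginal, so they are means of
  \<open>time_sep\<close>; in particular the defect is finite.\<close>

lemma defect_eq: "defect R r \<alpha> n \<gamma> = ereal (real r - mean_x - mean_y)"
  by (simp add: defect_def ell1_return_left ell1_return_right lazy_supports)

text \<open>The only estimate in the locale that uses the curvature: the transport bound
  \<open>n + r - mean_x - mean_y\<close>, divided by \<open>n\<close> and lowered by 1, must still
  be at least \<open>K\<close>.\<close>

lemma curvature_bound:
  assumes "ereal K \<le> curvature R r \<alpha> n \<gamma>"
  shows "K * real n \<le> real r - mean_x - mean_y"
proof -
  let ?L = "ell1 R \<mu>x \<mu>y"
  have n: "real n > 0" using r by simp
  have t: "time_sep R (\<gamma> 0) (\<gamma> n) = n" "time_sep R (\<gamma> 0) (\<gamma> (n + r)) = n + r"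
    by (rule geodesic_time_sep[OF causal geo]; simp)+
  have up: "?L \<le> ereal (real (n + r) - mean_x - mean_y)"
    using ell1_le_time_sep_minus[OF causal lazy_supports(1-2), of "\<gamma> 0" "\<gamma> (n + r)"] lazy_supports t
    by simp
  have "ereal K \<le> ?L / ereal (real n) - 1"
    using assms by (simp add: curvature_def t)
  moreover have "?L / ereal (real n) - 1 \<le> ereal (real (n + r) - mean_x - mean_y) / ereal (real n) - 1"
    using up n by (intro ereal_minus_mono ereal_divide_right_mono) auto
  ultimately have "ereal K \<le> ereal (real (n + r) - mean_x - mean_y) / ereal (real n) - 1"
    by (rule order_trans)
  then have "K \<le> (real (n + r) - mean_x - mean_y) / real n - 1"
    using n by (simp add: one_ereal_def)
  then show ?thesis
    using n by (simp add: field_simps)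
qed

text \<open>Each diamond contains \<open>r + 1\<close> distinct points of the geodesic. This keeps
  the denominators \<open>card - 1\<close> at least \<open>r\<close>.\<close>

lemma card_diamonds: "real r + 1 \<le> real (card Dx)" "real r + 1 \<le> real (card Dy)"
proof -
  have "card (\<gamma> ` {0..r}) \<le> card Dx" "card (\<gamma> ` {n..n+r}) \<le> card Dy"
    using r causal_chain_in_diamond[OF causal chain]
    by (intro card_mono finite_diamond[OF causal]; force)+
  moreover have "card (\<gamma> ` {0..r}) = r + 1" "card (\<gamma> ` {n..n+r}) = r + 1"
    using r by (subst card_image; force intro: inj_on_subset[OF inj_on_causal_chain[OF causal chain(1)]])+
  ultimately show "real r + 1 \<le> real (card Dx)" "real r + 1 \<le> real (card Dy)"
    by linarith+
qed

lemma card_diamonds_minus: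
  "real (card (Dx - {\<gamma> 0})) = real (card Dx) - 1" "real (card (Dy - {\<gamma> n})) = real (card Dy) - 1"
proof -
  have "\<gamma> 0 \<in> Dx" "\<gamma> n \<in> Dy"
    using r causal_chain_in_diamond[OF causal chain] by simp_all
  then show "real (card (Dx - {\<gamma> 0})) = real (card Dx) - 1"
    "real (card (Dy - {\<gamma> n})) = real (card Dy) - 1"
    using card_diamonds r by (simp_all add: card_Diff_singleton of_nat_diff)
qed

text \<open>The point \<open>\<gamma> i\<close> contributes at least \<open>i\<close> and every
  other point except the base at least 1. With \<open>N = card Dx - 1\<close> the sum is at least
  \<open>r (r + 1) / 2 + (N - r) = r (r - 1) / 2 + N\<close>.\<close>

lemma mean_x_ge: "(1 - \<alpha>) * (1 + real r * (real r - 1) / (2 * (real (card Dx) - 1))) \<le> mean_x"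
proof -
  let ?f = "\<lambda>z. real (time_sep R (\<gamma> 0) z)" and ?N = "real (card Dx) - 1"
  have inj: "inj_on \<gamma> {..n + r}"
    by (rule inj_on_causal_chain[OF causal chain(1)])
  have "(\<Sum>i\<in>{1..r}. real i) + (real (card (Dx - {\<gamma> 0})) - real (card {1..r}))
      \<le> sum ?f (Dx - {\<gamma> 0})"
  proof (rule sum_ge_along_injection)
    show "inj_on \<gamma> {1..r}"
      by (rule inj_on_subset[OF inj]) (use r in auto)
    have "\<gamma> i \<noteq> \<gamma> 0" if "i \<in> {1..r}" for i
      using that r inj_onD[OF inj, of i 0] by auto
    then show "\<gamma> ` {1..r} \<subseteq> Dx - {\<gamma> 0}"
      using r causal_chain_in_diamond[OF causal chain, of 0 _ r] by auto
    show "real i \<le> ?f (\<gamma> i)" if "i \<in> {1..r}" for i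
      using that r time_sep_chain_ge[OF causal chain(1), of 0 i] by simp
    show "1 \<le> ?f z" if "z \<in> Dx - {\<gamma> 0} - \<gamma> ` {1..r}" for z
    proof -
      have "prec R (\<gamma> 0) z" using that by (auto simp: prec_def diamond_def)
      then show ?thesis using time_sep_ge_one[OF causal] by fastforce
    qed
  qed (simp add: finite_diamond[OF causal])
  moreover have "(\<Sum>i\<in>{1..r}. real i) = real r * (real r + 1) / 2"
    by (induction r) (simp_all add: field_simps)
  ultimately have "real r * (real r - 1) / 2 + ?N \<le> sum ?f (Dx - {\<gamma> 0})"
    by (simp add: card_diamonds_minus field_simps)
  moreover have N: "?N > 0" using card_diamonds(1) r by linarith
  ultimately have "(1 - \<alpha>) / ?N * (real r * (real r - 1) / 2 + ?N)
      \<le> (1 - \<alpha>) / ?N * sum ?f (Dx - {\<gamma> 0})"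
    using \<alpha> by (intro mult_left_mono) auto
  \<comment> \<open>The atom at the base contributes a nonnegative term, which is dropped.\<close>
  also have "\<dots> \<le> mean_x"
    using \<alpha> by (subst expectation_lazy_measure[OF causal prec_ends(1) \<alpha>]) simp
  also have "(1 - \<alpha>) / ?N * (real r * (real r - 1) / 2 + ?N) =
      (1 - \<alpha>) * (1 + real r * (real r - 1) / (2 * ?N))"
    using N by (simp add: field_simps)
  finally show ?thesis .
qed

text \<open>Distances now run to the future end, so the atom at the base counts at least
  \<open>\<alpha> * r\<close> and \<open>\<gamma> (n + i)\<close> at least \<open>r - i\<close>.
  With \<open>N = card Dy - 1\<close> the sum is at least
  \<open>r (r - 1) / 2 + (N - r) = r (r - 3) / 2 + N\<close>.\<close>

lemma mean_y_ge:
  "\<alpha> * real r + (1 - \<alpha>) * (1 + real r * (real r - 3) / (2 * (real (card Dy) - 1))) \<le> mean_y"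
proof -
  let ?f = "\<lambda>z. real (time_sep R z (\<gamma> (n + r)))" and ?N = "real (card Dy) - 1"
  have inj: "inj_on \<gamma> {..n + r}"
    by (rule inj_on_causal_chain[OF causal chain(1)])
  have "(\<Sum>i\<in>{1..r}. real r - real i) + (real (card (Dy - {\<gamma> n})) - real (card {1..r}))
      \<le> sum ?f (Dy - {\<gamma> n})"
  proof (rule sum_ge_along_injection)
    show "inj_on (\<lambda>i. \<gamma> (n + i)) {1..r}"
      by (rule inj_onI) (use inj_onD[OF inj] in fastforce)
    have "\<gamma> (n + i) \<noteq> \<gamma> n" if "i \<in> {1..r}" for i
      using that inj_onD[OF inj, of "n + i" n] by auto
    then show "(\<lambda>i. \<gamma> (n + i)) ` {1..r} \<subseteq> Dy - {\<gamma> n}"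
      using causal_chain_in_diamond[OF causal chain, of n _ "n + r"] by auto
    show "real r - real i \<le> ?f (\<gamma> (n + i))" if "i \<in> {1..r}" for i
      using that time_sep_chain_ge[OF causal chain(1), of "n + i" "n + r"] by simp
    show "1 \<le> ?f z" if "z \<in> Dy - {\<gamma> n} - (\<lambda>i. \<gamma> (n + i)) ` {1..r}" for z
    proof -
      \<comment> \<open>The end point, at distance 0 from itself, is the image of
        \<open>i = r\<close> and so escapes the lower bound 1.\<close>
      have "z \<noteq> \<gamma> (n + r)" using that r by auto
      then have "prec R z (\<gamma> (n + r))" using that by (auto simp: prec_def diamond_def)
      then show ?thesis using time_sep_ge_one[OF causal] by fastforce
    qed
  qed (simp add: finite_diamond[OF causal])
  moreover have "(\<Sum>i\<in>{1..r}. real i) = real r * (real r + 1) / 2"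
    by (induction r) (simp_all add: field_simps)
  ultimately have "real r * (real r - 3) / 2 + ?N \<le> sum ?f (Dy - {\<gamma> n})"
    by (simp add: card_diamonds_minus sum_subtractf field_simps)
  moreover have N: "?N > 0" using card_diamonds(2) r by linarith
  ultimately have "(1 - \<alpha>) / ?N * (real r * (real r - 3) / 2 + ?N)
      \<le> (1 - \<alpha>) / ?N * sum ?f (Dy - {\<gamma> n})"
    using \<alpha> by (intro mult_left_mono) auto
  moreover have "\<alpha> * real r \<le> \<alpha> * ?f (\<gamma> n)"
    using \<alpha> time_sep_chain_ge[OF causal chain(1), of n "n + r"] by (intro mult_left_mono) auto
  moreover have "mean_y = \<alpha> * ?f (\<gamma> n) + (1 - \<alpha>) / ?N * sum ?f (Dy - {\<gamma> n})"
    by (rule expectation_lazy_measure[OF causal prec_ends(2) \<alpha>])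
  moreover have "(1 - \<alpha>) / ?N * (real r * (real r - 3) / 2 + ?N) =
      (1 - \<alpha>) * (1 + real r * (real r - 3) / (2 * ?N))"
    using N by (simp add: field_simps)
  ultimately show ?thesis by linarith
qed

text \<open>The constant terms combine as \<open>r - \<alpha> * r - 2 * (1 - \<alpha>) = (1 -
  \<alpha>) * (r - 2)\<close>.\<close>

lemma defect_le:
  "real r - mean_x - mean_y \<le> (1 - \<alpha>) * (real r - 2
     - real r * (real r - 1) / (2 * (real (card Dx) - 1))
     - real r * (real r - 3) / (2 * (real (card Dy) - 1)))"
  using mean_x_ge mean_y_ge by (simp add: algebra_simps)

end

section \<open>The length bound, the diameter bound and the explicit defect bounds\<close>

theorem theorem3p10:
  fixes C :: "'a set" and R :: "'a rel" and r :: nat and \<alpha> K :: real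
  assumes "causal_set C R"
    and "r \<ge> 2"
    and "0 \<le> \<alpha>" and "\<alpha> \<le> 1"
    and "K > 0"
    and "\<And>n \<gamma>. n \<ge> r \<Longrightarrow> geodesic C R \<gamma> (n + r) \<Longrightarrow> curvature R r \<alpha> n \<gamma> \<ge> ereal K"
  shows "(\<forall>n \<gamma>. n \<ge> r \<and> geodesic C R \<gamma> (n + r) \<longrightarrow>
            ereal (real (time_sep R (\<gamma> 0) (\<gamma> (n + r)))) \<le>
              ereal (real r) + defect R r \<alpha> n \<gamma> / ereal K)
    \<and> (diam R \<ge> ereal (2 * real r) \<longrightarrow>
         diam R \<le> ereal (real r) +
           (SUP (n, \<gamma>)\<in>{(n, \<gamma>). n \<ge> r \<and> geodesic C R \<gamma> (n + r)}. defect R r \<alpha> n \<gamma>) / ereal K)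
    \<and> (\<forall>n \<gamma>. n \<ge> r \<and> geodesic C R \<gamma> (n + r) \<longrightarrow>
         (let Nx = real (card (diamond R (\<gamma> 0) (\<gamma> r)));
              Ny = real (card (diamond R (\<gamma> n) (\<gamma> (n + r))))
          in (r = 2 \<longrightarrow>
                defect R r \<alpha> n \<gamma> \<le> ereal ((1 - \<alpha>) * (1 / (Ny - 1) - 1 / (Nx - 1)))
                \<and> (1 - \<alpha>) * (1 / (Ny - 1) - 1 / (Nx - 1)) \<le> (1 - \<alpha>) / 2)
           \<and> (r > 2 \<longrightarrow>
                defect R r \<alpha> n \<gamma> \<le>
                  ereal ((1 - \<alpha>) * (real r - 2
                     - real r * (real r - 1) / (2 * (Nx - 1))
                     - real r * (real r - 3) / (2 * (Ny - 1))))
                \<and> (1 - \<alpha>) * (real r - 2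
                     - real r * (real r - 1) / (2 * (Nx - 1))
                     - real r * (real r - 3) / (2 * (Ny - 1))) < (1 - \<alpha>) * (real r - 2))))"
proof -
  let ?S = "{(n, \<gamma>). r \<le> n \<and> geodesic C R \<gamma> (n + r)}"
  have cg: "causal_geodesic C R r n \<alpha> \<gamma>" if "r \<le> n" "geodesic C R \<gamma> (n + r)" for n \<gamma>
    using assms(1-4) that by unfold_locales auto
  have main: "ereal (real (n + r)) \<le> ereal (real r) + defect R r \<alpha> n \<gamma> / ereal K"
    if g: "r \<le> n" "geodesic C R \<gamma> (n + r)" for n \<gamma>
  proof -
    interpret causal_geodesic C R r n \<alpha> \<gamma> by (rule cg[OF g])
    show ?thesis
      \<comment> \<open>Dividing \<open>K n \<le> J\<close> by \<open>K\<close> and adding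
        \<open>r\<close> gives the bound on \<open>n + r\<close>.\<close>
      using curvature_bound[OF assms(6)[OF g]] assms(5)
      by (simp add: defect_eq field_simps)
  qed
  have part1: "ereal (real (time_sep R (\<gamma> 0) (\<gamma> (n + r)))) \<le>
      ereal (real r) + defect R r \<alpha> n \<gamma> / ereal K"
    if g: "r \<le> n" "geodesic C R \<gamma> (n + r)" for n \<gamma>
    using main[OF g] g(2) by (simp add: geodesic_def)
  have part2: "diam R \<le> ereal (real r) + (SUP (n, \<gamma>)\<in>?S. defect R r \<alpha> n \<gamma>) / ereal K"
    (is "_ \<le> ?B") if d: "ereal (2 * real r) \<le> diam R"
  proof -
    have long: "ereal (real (time_sep R x y)) \<le> ?B"
      if xy: "(x, y) \<in> R" "2 * r \<le> time_sep R x y" for x y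
    proof -
      \<comment> \<open>This \<open>n\<close> makes \<open>n + r\<close> the length of a geodesic
        from \<open>x\<close> to \<open>y\<close>; separation at least \<open>2 * r\<close> is
        exactly \<open>r \<le> n\<close>.\<close>
      define n where "n = time_sep R x y - r"
      then have n: "time_sep R x y = n + r" "r \<le> n"
        using xy(2) by simp_all
      obtain \<gamma> where \<gamma>: "geodesic C R \<gamma> (n + r)"
        by (rule obtain_geodesic[OF assms(1) xy(1)]) (simp add: n(1))
      have "defect R r \<alpha> n \<gamma> \<le> (SUP (n, \<gamma>)\<in>?S. defect R r \<alpha> n \<gamma>)"
        using n \<gamma> by (intro SUP_upper2[of "(n, \<gamma>)"]) auto
      then have "ereal (real r) + defect R r \<alpha> n \<gamma> / ereal K \<le> ?B"
        using assms(5) by (intro add_left_mono ereal_divide_right_mono) auto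
      then show ?thesis
        using order_trans[OF main[OF n(2) \<gamma>]] n(1) by simp
    qed
    \<comment> \<open>Integrality is used: if all separations were below \<open>2 * r\<close>, their
      supremum would be at most \<open>2 * r - 1\<close>.\<close>
    have "\<exists>x y. (x, y) \<in> R \<and> 2 * r \<le> time_sep R x y"
    proof (rule ccontr)
      assume short: "\<not> ?thesis"
      have "real (time_sep R x y) \<le> 2 * real r - 1" if "(x, y) \<in> R" for x y
      proof -
        have "time_sep R x y + 1 \<le> 2 * r"
          using short that by (metis Suc_eq_plus1 not_less_eq_eq)
        then show ?thesis by linarith
      qed
      then have "diam R \<le> ereal (2 * real r - 1)"
        unfolding diam_def by (intro SUP_least) auto
      with d have "ereal (2 * real r) \<le> ereal (2 * real r - 1)"
        by (rule order_trans)
      then show False by simp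
    qed
    then obtain x y where xy: "(x, y) \<in> R" "2 * r \<le> time_sep R x y"
      by blast
    have "ereal (real (time_sep R u v)) \<le> ?B" if "(u, v) \<in> R" for u v
    \<comment> \<open>A pair that is too close to carry an admissible geodesic is dominated by the
      far pair \<open>x\<close>, \<open>y\<close>.\<close>
    proof (cases "2 * r \<le> time_sep R u v")
      case False
      then have "ereal (real (time_sep R u v)) \<le> ereal (real (time_sep R x y))"
        using xy by simp
      also have "\<dots> \<le> ?B" by (rule long[OF xy])
      finally show ?thesis .
    qed (use long that in auto)
    then show ?thesis
      unfolding diam_def by (intro SUP_least) auto
  qed
  have part3: "(r = 2 \<longrightarrow>
        defect R r \<alpha> n \<gamma> \<le> ereal ((1 - \<alpha>) * (1 / (Ny - 1) - 1 / (Nx - 1)))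
        \<and> (1 - \<alpha>) * (1 / (Ny - 1) - 1 / (Nx - 1)) \<le> (1 - \<alpha>) / 2)
     \<and> (r > 2 \<longrightarrow>
        defect R r \<alpha> n \<gamma> \<le> ereal ((1 - \<alpha>) * (real r - 2
             - real r * (real r - 1) / (2 * (Nx - 1)) - real r * (real r - 3) / (2 * (Ny - 1))))
        \<and> (1 - \<alpha>) * (real r - 2
             - real r * (real r - 1) / (2 * (Nx - 1)) - real r * (real r - 3) / (2 * (Ny - 1)))
          < (1 - \<alpha>) * (real r - 2))"
    if g: "r \<le> n" "geodesic C R \<gamma> (n + r)"
      and N: "Nx = real (card (diamond R (\<gamma> 0) (\<gamma> r)))"
        "Ny = real (card (diamond R (\<gamma> n) (\<gamma> (n + r))))" for n \<gamma> Nx Ny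
  proof (intro conjI impI)
    interpret causal_geodesic C R r n \<alpha> \<gamma> by (rule cg[OF g])
    let ?b = "(1 - \<alpha>) * (real r - 2
      - real r * (real r - 1) / (2 * (Nx - 1)) - real r * (real r - 3) / (2 * (Ny - 1)))"
    have le: "real r - mean_x - mean_y \<le> ?b"
      using defect_le by (simp add: N)
    then show "defect R r \<alpha> n \<gamma> \<le> ereal ?b"
      by (simp add: defect_eq)
    have Nx: "Nx \<ge> real r + 1" and Ny: "Ny \<ge> real r + 1"
      using card_diamonds by (simp_all add: N)
    {
      assume r2: "r = 2"
      show "defect R r \<alpha> n \<gamma> \<le> ereal ((1 - \<alpha>) * (1 / (Ny - 1) - 1 / (Nx - 1)))"
      proof -
        \<comment> \<open>At \<open>r = 2\<close> the numerators \<open>r (r - 1)\<close> and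
          \<open>r (r - 3)\<close> are 2 and -2, which explains the sign change.\<close>
        have "real r * (real r - 1) / (2 * (Nx - 1)) = 1 / (Nx - 1)"
          "real r * (real r - 3) / (2 * (Ny - 1)) = - (1 / (Ny - 1))"
          using Nx Ny r2 by (simp_all add: field_simps)
        moreover have "real r - 2 = 0"
          using r2 by simp
        ultimately have "?b = (1 - \<alpha>) * (1 / (Ny - 1) - 1 / (Nx - 1))"
          by (simp only:) simp
        with le show ?thesis
          unfolding defect_eq ereal_less_eq by (simp only:)
      qed
      \<comment> \<open>Here \<open>Ny \<ge> r + 1 = 3\<close>.\<close>
      have "1 / (Ny - 1) \<le> 1 / 2" "0 \<le> 1 / (Nx - 1)"
        using Nx Ny r2 by (auto intro!: frac_le)
      then have "1 / (Ny - 1) - 1 / (Nx - 1) \<le> 1 / 2" by linarith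
      from mult_left_mono[OF this, of "1 - \<alpha>"]
      show "(1 - \<alpha>) * (1 / (Ny - 1) - 1 / (Nx - 1)) \<le> (1 - \<alpha>) / 2"
        using \<alpha> by simp
    next
      assume r3: "r > 2"
      \<comment> \<open>Strictness needs \<open>\<alpha> < 1\<close>: for \<open>\<alpha> = 1\<close> the defect would vanish, whereas it is at
        least \<open>K n > 0\<close>.\<close>
      have "0 < K * real n"
        using assms(5) r by simp
      also have "\<dots> \<le> ?b"
        using curvature_bound[OF assms(6)[OF g]] le by linarith
      finally have "\<alpha> < 1"
        using \<alpha> by (cases "\<alpha> = 1") auto
      moreover have "0 < real r * (real r - 1) / (2 * (Nx - 1))"
        using r3 Nx by (intro divide_pos_pos mult_pos_pos) auto
      \<comment> \<open>This term vanishes at \<open>r = 3\<close>; strictness comes from the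
        preceding one.\<close>
      moreover have "0 \<le> real r * (real r - 3) / (2 * (Ny - 1))"
        using r3 Ny by (intro divide_nonneg_nonneg mult_nonneg_nonneg) auto
      ultimately show "?b < (1 - \<alpha>) * (real r - 2)"
        by (intro mult_strict_left_mono) auto
    }
  qed
  show ?thesis
    unfolding Let_def using part1 part2 part3 by blast
qed

end
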